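(* Let $L,R,\alpha,\beta$ be positive real constants, let $d$ be a real constant with $0<d<\pi/2$, and let $F\in\mathbf{L}^{\mathrm{DE}}_{L,R,\alpha,\beta}(\mathscr{D}_d)$. Let $\mu=\min\{\alpha,\beta\}$, let $n$ be a positive integer, let $$h=\frac{\operatorname{arsinh}(dn/\mu)}{n},$$ and let $$M=\left\lceil\frac{1}{h}\operatorname{arsinh}\left(\frac{\mu}{\alpha}\,q\left(\frac{dn}{\mu}\right)\right)\right\rceil,\qquad N=\left\lceil\frac{1}{h}\operatorname{arsinh}\left(\frac{\mu}{\beta}\,q\left(\frac{dn}{\mu}\right)\right)\right\rceil.$$ Then $$\sup_{x\in\mathbb{R}}\left|F(x)-\sum_{k=-M}^{N}F(kh)\operatorname{sinc}\left(\frac{x-kh}{h}\right)\right|\le C\,e^{-\pi dn/\operatorname{arsinh}(dn/\mu)},$$ where $C$ is the constant, independent of $n$, given by $$C=\frac{2}{\pi d}\left[\frac{2L}{\pi\mu\left(1-e^{-2\pi\mu q(d/\mu)}\right)\cos^{\alpha+\beta}\left(\frac{\pi}{2}\sin d\right)\cos d}+R\right].$$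
   Context: For $d>0$, $\mathscr{D}_d=\{\zeta\in\mathbb{C}:|\operatorname{Im}\zeta|<d\}$. For positive constants $L,R,\alpha,\beta$ and $0<d<\pi/2$, $\mathbf{L}^{\mathrm{DE}}_{L,R,\alpha,\beta}(\mathscr{D}_d)$ denotes the family of functions $F$ that are analytic in $\mathscr{D}_d$ and satisfy $$|F(\zeta)|\le\frac{L}{|1+e^{-\pi\sinh\zeta}|^{\alpha}\,|1+e^{\pi\sinh\zeta}|^{\beta}}\quad\text{for all }\zeta\in\mathscr{D}_d,$$ $$|F(x)|\le\frac{R}{(1+e^{-\pi\sinh x})^{\alpha}(1+e^{\pi\sinh x})^{\beta}}\quad\text{for all }x\in\mathbb{R}.$$ $\operatorname{sinc}x=\sin(\pi x)/(\pi x)$, with $\operatorname{sinc}0=1$. $\operatorname{arsinh}x=\log(x+\sqrt{1+x^2})$ is the inverse hyperbolic sine. For $x>0$, $q(x)=x/\operatorname{arsinh}x$. $\lceil\cdot\rceil$ is the ceiling function. *)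

theory Defs
  imports "HOL-Analysis.Analysis"
begin

definition strip :: "real \<Rightarrow> complex set" where
  "strip d = {\<zeta>. \<bar>Im \<zeta>\<bar> < d}"

text \<open>
  Functions are total on the complex plane; membership only constrains their values on
  \<open>strip d\<close>. For \<open>0 < d < pi / 2\<close> neither \<open>1 + exp (- pi * sinh \<zeta>)\<close> nor
  \<open>1 + exp (pi * sinh \<zeta>)\<close> vanishes on \<open>strip d\<close>, so the bases of the real powers
  below are positive and the divisions are genuine.
\<close>

definition L_DE :: "real \<Rightarrow> real \<Rightarrow> real \<Rightarrow> real \<Rightarrow> real \<Rightarrow> (complex \<Rightarrow> complex) set" where
  "L_DE L R \<alpha> \<beta> d = {F. F analytic_on strip d \<and>
     (\<forall>\<zeta>\<in>strip d. norm (F \<zeta>) \<le>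
        L / (norm (1 + exp (- of_real pi * sinh \<zeta>)) powr \<alpha> *
             norm (1 + exp (of_real pi * sinh \<zeta>)) powr \<beta>)) \<and>
     (\<forall>x::real. norm (F (of_real x)) \<le>
        R / ((1 + exp (- pi * sinh x)) powr \<alpha> * (1 + exp (pi * sinh x)) powr \<beta>))}"

text \<open>The normalized sinc, unlike the abbreviation \<open>sinc\<close> of \<open>HOL-Probability.Sinc_Integral\<close>.\<close>

definition nsinc :: "real \<Rightarrow> real" where
  "nsinc x = (if x = 0 then 1 else sin (pi * x) / (pi * x))"

text \<open>Only used for positive arguments.\<close>

definition q :: "real \<Rightarrow> real" where
  "q x = x / arsinh x"

end

theory Submission
  imports Defs "HOL-Complex_Analysis.Residue_Theorem"
begin

text \<open>
  The truncated sinc interpolant differs from \<open>F\<close> for two reasons, and the mesh size \<open>h\<close> and the cut-offs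
  \<open>M\<close> and \<open>N\<close> balance the two errors: both are of the order \<open>exp (- pi * d / h)\<close>, where
  \<open>d / h = \<mu> * q (d * n / \<mu>)\<close>.

  For the discretization error, let \<open>x\<close> be different from all nodes \<open>k * h\<close>, where interpolation is exact.
  By the residue theorem, the error at \<open>x\<close> of the interpolant that uses the nodes with \<open>\<bar>k\<bar> \<le> m\<close> is
  \<open>sin (pi * x / h) / (2 * pi * \<i>)\<close> times the integral of
  \<open>F z / ((z - x) * sin (pi * z / h))\<close> around a rectangle of half-height \<open>y < d\<close> that contains \<open>x\<close> and these nodes
  (\<open>sinc_interpolation_contour\<close>). As \<open>m\<close> tends to infinity the vertical sides contribute nothing. On the
  horizontal sides \<open>\<bar>sin (pi * z / h)\<bar> \<ge> sinh (pi * y / h)\<close>, so the error is at most the integral of \<open>\<bar>F\<bar>\<close>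
  over both lines divided by \<open>2 * pi * y * sinh (pi * y / h)\<close>, and then \<open>y\<close> tends to \<open>d\<close>.

  The integral is finite because \<open>F\<close> decays double exponentially in the whole strip, not only on the
  real line (\<open>L_DE_decay\<close>). This rests on the bound
  \<open>\<bar>1 + exp (pi * sinh (x + \<i> y))\<bar> \<ge> (1 + exp (pi * sinh x * cos y)) * cos (pi / 2 * sin y)\<close>
  (\<open>norm_one_plus_exp_sinh_ge\<close>), whose point is that the oscillating phase of the exponential cannot
  make \<open>\<bar>1 + exp w\<bar> / (1 + \<bar>exp w\<bar>)\<close> with \<open>w = pi * sinh (x + \<i> y)\<close> smaller than it is at \<open>x = 0\<close>.

  For the truncation error, sinc is bounded by \<open>1\<close>, so the dropped terms are at most the sums of
  \<open>R * exp (- pi * \<beta> * sinh (k * h))\<close> over \<open>k > N\<close> and of \<open>R * exp (- pi * \<alpha> * sinh (k * h))\<close> over \<open>k > M\<close>. They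
  telescope up to a factor (\<open>sum_exp_sinh_le\<close>). The cut-offs guarantee \<open>sinh (N * h) \<ge> \<mu> / \<beta> * q (d * n / \<mu>)\<close>
  and \<open>sinh (M * h) \<ge> \<mu> / \<alpha> * q (d * n / \<mu>)\<close>, and each tail becomes at most
  \<open>R / (pi * d) * exp (- pi * d / h)\<close>.

  The factor \<open>1 / (1 - exp (- 2 * pi * d / h))\<close> that remains in the discretization error still depends on
  \<open>n\<close>; it is largest for \<open>n = 1\<close>, since \<open>q t \<le> q (n * t)\<close> (\<open>q_mono_nat\<close>).
\<close>

section \<open>A lower bound for \<open>1 + exp (pi * sinh \<zeta>)\<close> in the strip\<close>

text \<open>
  The graph of \<open>sin\<close> lies below its tangent at \<open>a\<close> to the right of \<open>a\<close>, and for good: the addition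
  theorem for \<open>t = a + (t - a)\<close> controls \<open>\<bar>sin t\<bar>\<close> even far beyond \<open>pi\<close>.
\<close>

lemma abs_sin_le_tangent:
  fixes a t :: real
  assumes "0 \<le> a" "a \<le> pi / 2" "a \<le> t"
  shows "\<bar>sin t\<bar> \<le> sin a + cos a * (t - a)"
proof -
  define \<delta> where "\<delta> = t - a"
  have sa: "0 \<le> sin a" and ca: "0 \<le> cos a"
    using assms by (auto intro: sin_ge_zero cos_ge_zero)
  have "\<bar>sin t\<bar> = \<bar>sin a * cos \<delta> + cos a * sin \<delta>\<bar>"
    by (simp add: \<delta>_def flip: sin_add)
  also have "\<dots> \<le> sin a * \<bar>cos \<delta>\<bar> + cos a * \<bar>sin \<delta>\<bar>"
    using sa ca abs_triangle_ineq[of "sin a * cos \<delta>" "cos a * sin \<delta>"] by (simp add: abs_mult)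
  also have "\<dots> \<le> sin a * 1 + cos a * \<bar>\<delta>\<bar>"
    using sa ca abs_sin_le_one by (intro add_mono mult_left_mono abs_sin_x_le_abs_x) auto
  also have "\<dots> = sin a + cos a * (t - a)"
    using assms by (simp add: \<delta>_def)
  finally show ?thesis .
qed

text \<open>
  A form of \<open>tan a / a \<ge> 1 / ((pi / 2)\<^sup>2 - a\<^sup>2)\<close>. The constant \<open>1\<close> is not sharp, which is why the
  tangent \<open>cos a \<le> pi / 2 - a\<close> and the chord \<open>sin a \<ge> 2 * a / pi\<close> suffice.
\<close>

lemma mult_cos_le_sin:
  fixes a :: real
  assumes "0 \<le> a" "a \<le> pi / 2"
  shows "a * cos a \<le> ((pi / 2)\<^sup>2 - a\<^sup>2) * sin a"
proof -
  have cos: "cos a \<le> pi / 2 - a"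
    using sin_x_le_x[of "pi / 2 - a"] assms by (simp add: sin_diff)
  have "concave_on {0..pi / 2} sin"
    by (rule f''_le0_imp_concave[where f' = cos and f'' = "\<lambda>x. - sin x"])
       (auto intro!: derivative_eq_intros sin_ge_zero)
  then have sin: "2 * a / pi \<le> sin a"
    using concave_onD_Icc'[of 0 "pi / 2" sin a] assms by simp
  have "a * cos a \<le> a * (pi / 2 - a)"
    using cos assms by (intro mult_left_mono)
  also have "\<dots> \<le> (pi / 2 - a) * ((pi / 2 + a) * (2 * a / pi))"
  proof -
    have "a \<le> (pi / 2 + a) * (2 * a / pi)"
      using assms by (simp add: field_simps)
    then have "(pi / 2 - a) * a \<le> (pi / 2 - a) * ((pi / 2 + a) * (2 * a / pi))"
      using assms by (intro mult_left_mono) auto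
    then show ?thesis by (simp add: mult.commute)
  qed
  also have "\<dots> \<le> (pi / 2 - a) * ((pi / 2 + a) * sin a)"
    using sin assms by (intro mult_left_mono) auto
  also have "\<dots> = ((pi / 2)\<^sup>2 - a\<^sup>2) * sin a"
    unfolding power2_eq_square square_diff_square_factored by (simp only: mult_ac)
  finally show ?thesis .
qed

lemma cosh_ge_one_plus_half_square: "1 + p\<^sup>2 / 2 \<le> cosh (p :: real)"
proof -
  have "cosh p = 1 + 2 * (sinh (p / 2))\<^sup>2"
    using cosh_add[of "p / 2" "p / 2"] by (simp add: power2_eq_square cosh_square_eq flip: power2_eq_square)
  moreover have "(p / 2)\<^sup>2 \<le> (sinh (p / 2))\<^sup>2"
    using real_le_abs_sinh[of "p / 2"]
    by (subst abs_le_square_iff [symmetric]) (simp add: sinh_def exp_minus)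
  ultimately show ?thesis
    by (simp add: power2_eq_square)
qed

text \<open>
  With \<open>a = pi / 2 * sin y\<close>, both sides are compared with their first-order expansions in
  \<open>cosh x - 1\<close>: the tangent bound gives \<open>sin a + a * cos a * (cosh x - 1)\<close> on the left, and
  \<open>cosh p \<ge> 1 + p\<^sup>2 / 2\<close> gives at least \<open>sin a + ((pi / 2)\<^sup>2 - a\<^sup>2) * sin a * (cosh x - 1)\<close> on the
  right, since \<open>sinh\<^sup>2 x = (cosh x - 1) * (cosh x + 1)\<close>.
\<close>

lemma abs_sin_cosh_le:
  fixes x y :: real
  assumes y: "0 \<le> y" "y \<le> pi / 2"
  shows "\<bar>sin (pi / 2 * (cosh x * sin y))\<bar> \<le> sin (pi / 2 * sin y) * cosh (pi / 2 * (sinh x * cos y))"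
proof -
  define a where "a = pi / 2 * sin y"
  have a: "0 \<le> a" "a \<le> pi / 2"
    using y by (auto simp: a_def sin_ge_zero)
  have sa: "0 \<le> sin a"
    using a by (intro sin_ge_zero) auto
  have ch: "1 \<le> cosh x" by (rule cosh_real_ge_1)
  have "(pi / 2)\<^sup>2 - a\<^sup>2 = (pi / 2)\<^sup>2 * (cos y)\<^sup>2"
    unfolding a_def power_mult_distrib cos_squared_eq right_diff_distrib by simp
  then have p2: "(pi / 2 * (sinh x * cos y))\<^sup>2 = ((pi / 2)\<^sup>2 - a\<^sup>2) * ((cosh x)\<^sup>2 - 1)"
    unfolding cosh_square_eq power_mult_distrib by simp
  have w: "0 \<le> (pi / 2)\<^sup>2 - a\<^sup>2"
    using a by (simp add: power_mono)
  have "a * 1 \<le> a * cosh x"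
    using a ch by (intro mult_left_mono)
  then have "\<bar>sin (a * cosh x)\<bar> \<le> sin a + cos a * (a * cosh x - a)"
    using a by (intro abs_sin_le_tangent) auto
  also have "\<dots> = sin a + (a * cos a) * (cosh x - 1)"
    by (simp add: algebra_simps)
  also have "\<dots> \<le> sin a + (((pi / 2)\<^sup>2 - a\<^sup>2) * sin a) * (((cosh x)\<^sup>2 - 1) / 2)"
  proof -
    have "0 \<le> (cosh x - 1)\<^sup>2" by simp
    then have "cosh x - 1 \<le> ((cosh x)\<^sup>2 - 1) / 2"
      by (simp add: power2_eq_square algebra_simps)
    then show ?thesis
      using w sa ch by (intro add_left_mono mult_mono[OF mult_cos_le_sin[OF a]]) auto
  qed
  also have "\<dots> = sin a * (1 + (pi / 2 * (sinh x * cos y))\<^sup>2 / 2)"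
  proof -
    have "sin a + w * sin a * (t / 2) = sin a * (1 + w * t / 2)" for w t :: real
      by (simp add: algebra_simps)
    then show ?thesis unfolding p2 .
  qed
  also have "\<dots> \<le> sin a * cosh (pi / 2 * (sinh x * cos y))"
    using sa by (intro mult_left_mono cosh_ge_one_plus_half_square)
  finally show ?thesis
    by (simp add: a_def mult_ac)
qed

text \<open>
  Writing the squared modulus relative to its value \<open>(1 + exp (Re w))\<^sup>2\<close> at \<open>Im w = 0\<close> isolates the
  loss caused by the phase of \<open>exp w\<close>; that loss is small where \<open>\<bar>Re w\<bar>\<close> is large.
\<close>

lemma norm_one_plus_exp_squared:
  "(norm (1 + exp w))\<^sup>2 = (1 + exp (Re w))\<^sup>2 * (1 - (sin (Im w / 2) / cosh (Re w / 2))\<^sup>2)"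
proof -
  define u v where "u = Re w" and "v = Im w"
  have c: "cos v = 1 - 2 * (sin (v / 2))\<^sup>2"
    using cos_double_sin[of "v / 2"] by simp
  have sc: "(cos v)\<^sup>2 + (sin v)\<^sup>2 = 1" by simp
  have "(norm (1 + exp w))\<^sup>2 = (1 + exp u * cos v)\<^sup>2 + (exp u * sin v)\<^sup>2"
    by (simp add: cmod_power2 Re_exp Im_exp u_def v_def)
  also have "\<dots> = 1 + 2 * exp u * cos v + (exp u)\<^sup>2 * ((cos v)\<^sup>2 + (sin v)\<^sup>2)"
    by algebra
  also have "\<dots> = (1 + exp u)\<^sup>2 - 4 * exp u * (sin (v / 2))\<^sup>2"
    unfolding sc unfolding c by (simp add: power2_eq_square algebra_simps)
  also have "4 * exp u = (1 + exp u)\<^sup>2 / (cosh (u / 2))\<^sup>2"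
  proof -
    have u: "exp u = (exp (u / 2))\<^sup>2"
      by (simp add: power2_eq_square flip: exp_add)
    then have "1 + exp u = 2 * cosh (u / 2) * exp (u / 2)"
      by (simp add: cosh_def exp_minus field_simps power2_eq_square)
    then have "(1 + exp u)\<^sup>2 = 4 * exp u * (cosh (u / 2))\<^sup>2"
      by (simp add: u power_mult_distrib)
    then show ?thesis
      by (simp add: field_simps)
  qed
  finally show ?thesis
    by (simp add: u_def v_def power_divide algebra_simps)
qed

text \<open>
  On a horizontal line other than the real one, the phase \<open>pi * cosh x * sin y\<close> of
  \<open>exp (pi * sinh (x + \<i> y))\<close> runs through all angles, so it repeatedly equals an odd multiple of \<open>pi\<close>. The modulus \<open>exp (pi * sinh x * cos y)\<close> is
  then already far enough from \<open>1\<close> that \<open>1 + exp (pi * sinh \<zeta>)\<close> is never smaller, relative to \<open>1\<close> plus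
  that modulus, than at \<open>x = 0\<close>. This trade-off is exactly \<open>abs_sin_cosh_le\<close>.
\<close>

lemma norm_one_plus_exp_sinh_ge:
  assumes "\<bar>Im \<zeta>\<bar> < pi / 2"
  shows "(1 + exp (pi * (sinh (Re \<zeta>) * cos (Im \<zeta>)))) * cos (pi / 2 * sin (Im \<zeta>))
          \<le> norm (1 + exp (of_real pi * sinh \<zeta>))"
proof -
  define y where "y = \<bar>Im \<zeta>\<bar>"
  define w where "w = of_real pi * sinh \<zeta>"
  have reim: "Re w = pi * (sinh (Re \<zeta>) * cos (Im \<zeta>))" "Im w = pi * (cosh (Re \<zeta>) * sin (Im \<zeta>))"
    unfolding w_def
    by (simp_all add: sinh_def cosh_def Re_exp Im_exp scaleR_conv_of_real field_simps)
  have y: "0 \<le> y" "y < pi / 2"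
    using assms by (auto simp: y_def)
  have cosy: "cos (Im \<zeta>) = cos y"
    by (simp add: y_def)
  have abssin: "\<bar>sin (c * sin (Im \<zeta>))\<bar> = \<bar>sin (c * sin y)\<bar>"
    and coss: "cos (c * sin (Im \<zeta>)) = cos (c * sin y)" for c
    by (auto simp: y_def abs_if)
  have "\<bar>sin (Im w / 2)\<bar> / cosh (Re w / 2) \<le> sin (pi / 2 * sin y)"
    using abs_sin_cosh_le[of y "Re \<zeta>"] y abssin[of "pi / 2 * cosh (Re \<zeta>)"]
    by (simp add: reim cosy divide_le_eq mult_ac)
  then have "(sin (Im w / 2) / cosh (Re w / 2))\<^sup>2 \<le> (sin (pi / 2 * sin y))\<^sup>2"
    by (subst abs_le_square_iff [symmetric]) auto
  then have "(cos (pi / 2 * sin y))\<^sup>2 \<le> 1 - (sin (Im w / 2) / cosh (Re w / 2))\<^sup>2"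
    by (simp add: cos_squared_eq)
  then have "((1 + exp (Re w)) * cos (pi / 2 * sin y))\<^sup>2 \<le> (norm (1 + exp w))\<^sup>2"
    unfolding norm_one_plus_exp_squared power_mult_distrib by (intro mult_left_mono) auto
  then show ?thesis
    unfolding coss[of "pi / 2"] reim[symmetric] w_def[symmetric]
    by (rule power2_le_imp_le) simp
qed

section \<open>Double exponential decay\<close>

text \<open>
  Of the two factors \<open>1 + exp (- u)\<close> and \<open>1 + exp u\<close> with \<open>u = pi * sinh (Re \<zeta>) * cos (Im \<zeta>)\<close>, one is at
  least \<open>exp \<bar>u\<bar>\<close> and the other at least \<open>1\<close>; which is which depends on the sign of \<open>u\<close>, so the smaller
  of the two exponents is guaranteed.
\<close>

lemma L_DE_decay:
  assumes "F \<in> L_DE L R \<alpha> \<beta> d" "0 \<le> L" "0 \<le> \<alpha>" "0 \<le> \<beta>" "d \<le> pi / 2"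
      and \<zeta>: "\<zeta> \<in> strip d"
  shows "norm (F \<zeta>) \<le> L / cos (pi / 2 * sin (Im \<zeta>)) powr (\<alpha> + \<beta>) *
           exp (- (pi * min \<alpha> \<beta> * cos (Im \<zeta>)) * \<bar>sinh (Re \<zeta>)\<bar>)"
proof -
  define u where "u = pi * (sinh (Re \<zeta>) * cos (Im \<zeta>))"
  define \<kappa> where "\<kappa> = cos (pi / 2 * sin (Im \<zeta>))"
  have im: "\<bar>Im \<zeta>\<bar> < pi / 2"
    using \<zeta> assms by (auto simp: strip_def)
  have cpos: "0 < cos (Im \<zeta>)"
    using im by (intro cos_gt_zero_pi) auto
  have "\<bar>sin (Im \<zeta>)\<bar> < 1"
    using cpos by (subst abs_square_less_1 [symmetric]) (simp add: sin_squared_eq)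
  then have "pi / 2 * - 1 < pi / 2 * sin (Im \<zeta>)" "pi / 2 * sin (Im \<zeta>) < pi / 2 * 1"
    by (intro mult_strict_left_mono; simp add: abs_less_iff)+
  then have \<kappa>: "0 < \<kappa>"
    unfolding \<kappa>_def by (intro cos_gt_zero_pi) simp_all
  have b1: "(1 + exp u) * \<kappa> \<le> norm (1 + exp (of_real pi * sinh \<zeta>))"
    using norm_one_plus_exp_sinh_ge[OF im] by (simp add: u_def \<kappa>_def)
  have b2: "(1 + exp (- u)) * \<kappa> \<le> norm (1 + exp (- of_real pi * sinh \<zeta>))"
    using norm_one_plus_exp_sinh_ge[of "- \<zeta>"] im by (simp add: u_def \<kappa>_def)
  have "0 < (1 + exp u) * \<kappa>" "0 < (1 + exp (- u)) * \<kappa>"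
    using \<kappa> by (simp_all add: add_pos_pos)
  with b1 b2 have pos: "0 < norm (1 + exp (of_real pi * sinh \<zeta>))"
      "0 < norm (1 + exp (- of_real pi * sinh \<zeta>))"
    by linarith+
  have *: "exp (min \<alpha> \<beta> * \<bar>u\<bar>) \<le> (1 + exp (- u)) powr \<alpha> * (1 + exp u) powr \<beta>"
  proof (cases "0 \<le> u")
    case True
    have "exp (min \<alpha> \<beta> * \<bar>u\<bar>) \<le> 1 * exp u powr \<beta>"
      using True by (simp add: powr_def mult_right_mono)
    also have "\<dots> \<le> (1 + exp (- u)) powr \<alpha> * (1 + exp u) powr \<beta>"
      using assms by (intro mult_mono powr_mono2 ge_one_powr_ge_zero) auto
    finally show ?thesis .
  next
    case False
    have "exp (min \<alpha> \<beta> * \<bar>u\<bar>) \<le> exp (- u) powr \<alpha> * 1"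
      using False by (simp add: powr_def mult_right_mono)
    also have "\<dots> \<le> (1 + exp (- u)) powr \<alpha> * (1 + exp u) powr \<beta>"
      using assms by (intro mult_mono powr_mono2 ge_one_powr_ge_zero) auto
    finally show ?thesis .
  qed
  have "\<kappa> powr (\<alpha> + \<beta>) * exp (min \<alpha> \<beta> * \<bar>u\<bar>)
         \<le> \<kappa> powr (\<alpha> + \<beta>) * ((1 + exp (- u)) powr \<alpha> * (1 + exp u) powr \<beta>)"
    using * by (intro mult_left_mono) auto
  also have "\<dots> = ((1 + exp (- u)) * \<kappa>) powr \<alpha> * ((1 + exp u) * \<kappa>) powr \<beta>"
    using \<kappa> by (simp add: powr_mult powr_add mult_ac)
  also have "\<dots> \<le> norm (1 + exp (- of_real pi * sinh \<zeta>)) powr \<alpha> * norm (1 + exp (of_real pi * sinh \<zeta>)) powr \<beta>"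
    using assms b1 b2 \<kappa> by (intro mult_mono powr_mono2) (auto intro!: mult_nonneg_nonneg add_nonneg_nonneg)
  finally have "L / (norm (1 + exp (- of_real pi * sinh \<zeta>)) powr \<alpha> * norm (1 + exp (of_real pi * sinh \<zeta>)) powr \<beta>)
      \<le> L / (\<kappa> powr (\<alpha> + \<beta>) * exp (min \<alpha> \<beta> * \<bar>u\<bar>))"
    using \<kappa> assms pos by (intro divide_left_mono mult_pos_pos) auto
  moreover have "norm (F \<zeta>) \<le> L / (norm (1 + exp (- of_real pi * sinh \<zeta>)) powr \<alpha> * norm (1 + exp (of_real pi * sinh \<zeta>)) powr \<beta>)"
    using assms by (auto simp: L_DE_def)
  ultimately have "norm (F \<zeta>) \<le> L / (\<kappa> powr (\<alpha> + \<beta>) * exp (min \<alpha> \<beta> * \<bar>u\<bar>))"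
    by linarith
  also have "\<dots> = L / \<kappa> powr (\<alpha> + \<beta>) * exp (- (pi * min \<alpha> \<beta> * cos (Im \<zeta>)) * \<bar>sinh (Re \<zeta>)\<bar>)"
    using cpos by (simp add: u_def abs_mult exp_minus divide_simps mult_ac)
  finally show ?thesis
    by (simp add: \<kappa>_def)
qed

text \<open>
  On the real line each of the two one-sided rates is kept, as the two tails of the sinc series are
  cut off at different places.
\<close>

lemma L_DE_decay_real:
  assumes "F \<in> L_DE L R \<alpha> \<beta> d" "0 \<le> R" "0 \<le> \<alpha>" "0 \<le> \<beta>"
  shows "norm (F (of_real x)) \<le> R * exp (- (pi * \<beta>) * sinh x)"
    and "norm (F (of_real x)) \<le> R * exp (pi * \<alpha> * sinh x)"
proof -
  let ?A = "(1 + exp (- pi * sinh x)) powr \<alpha>" and ?B = "(1 + exp (pi * sinh x)) powr \<beta>"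
  have F: "norm (F (of_real x)) \<le> R / (?A * ?B)"
    using assms by (auto simp: L_DE_def)
  have A1: "1 \<le> ?A" and B1: "1 \<le> ?B"
    using assms by (auto intro!: ge_one_powr_ge_zero)
  have A2: "exp (- (pi * \<alpha> * sinh x)) \<le> ?A"
    using assms powr_mono2[of \<alpha> "exp (- pi * sinh x)" "1 + exp (- pi * sinh x)"]
    by (simp add: powr_def mult_ac)
  have B2: "exp (pi * \<beta> * sinh x) \<le> ?B"
    using assms powr_mono2[of \<beta> "exp (pi * sinh x)" "1 + exp (pi * sinh x)"]
    by (simp add: powr_def mult_ac)
  have "R / (?A * ?B) \<le> R / (1 * exp (pi * \<beta> * sinh x))"
    using assms A1 B2 by (intro divide_left_mono mult_mono mult_pos_pos) (auto simp: add_pos_pos order_less_imp_not_eq2)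
  with F show "norm (F (of_real x)) \<le> R * exp (- (pi * \<beta>) * sinh x)"
    by (simp add: exp_minus divide_inverse)
  have "R / (?A * ?B) \<le> R / (exp (- (pi * \<alpha> * sinh x)) * 1)"
    using assms A2 B1 by (intro divide_left_mono mult_mono mult_pos_pos) (auto simp: add_pos_pos order_less_imp_not_eq2)
  with F show "norm (F (of_real x)) \<le> R * exp (pi * \<alpha> * sinh x)"
    by (simp add: exp_minus divide_inverse)
qed

text \<open>
  The factor \<open>cosh t\<close>, harmless because it is at least \<open>1\<close>, makes a double exponential elementary to
  integrate.
\<close>

lemma integral_cosh_exp_sinh_le:
  fixes c A :: real
  assumes "0 < c" "0 \<le> A"
  defines "g \<equiv> \<lambda>t. cosh t * exp (- c * \<bar>sinh t\<bar>)"
  shows "g integrable_on {-A..A}" "integral {-A..A} g \<le> 2 / c"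
proof -
  let ?I = "(1 - exp (- c * sinh A)) / c"
  have "((\<lambda>t. cosh t * exp (- c * sinh t)) has_integral (- exp (- c * sinh A) / c) - (- exp (- c * sinh 0) / c)) {0..A}"
    using assms
    by (intro fundamental_theorem_of_calculus)
       (auto intro!: derivative_eq_intros simp: has_real_derivative_iff_has_vector_derivative [symmetric])
  then have pos: "(g has_integral ?I) {0..A}"
    unfolding g_def by (rule has_integral_eq_rhs [OF has_integral_eq, rotated]) (auto simp: diff_divide_distrib)
  then have "((\<lambda>t. g (- t)) has_integral ?I) {- A..- 0}"
    by (simp only: has_integral_reflect_real)
  then have neg: "(g has_integral ?I) {- A..0}"
    by (simp add: g_def)
  have "(g has_integral (?I + ?I)) {-A..A}"
    using has_integral_combine[OF _ _ neg pos] assms by simp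
  moreover have "?I + ?I \<le> 2 / c"
    using assms by (simp add: field_simps)
  ultimately show "g integrable_on {-A..A}" "integral {-A..A} g \<le> 2 / c"
    by (auto simp: has_integral_iff)
qed

text \<open>
  A sum of double exponentials telescopes up to a factor: with \<open>s\<^sub>j = sinh (a + j * h)\<close>
  and \<open>i = j - 1\<close>,
  \<open>exp (- c * s\<^sub>j) * (exp (c * (s\<^sub>j - s\<^sub>i)) - 1)\<close> is a difference of consecutive terms, and
  \<open>exp z - 1 \<ge> z\<close> together with \<open>s\<^sub>j - s\<^sub>i \<ge> h * cosh a\<close> bounds the second factor from below. The
  result is the value of the integral of \<open>cosh t * exp (- c * sinh t)\<close> from \<open>a\<close> to \<open>a + m * h\<close>, divided
  by \<open>h * cosh a\<close>.
\<close>

lemma sum_exp_sinh_le: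
  fixes a c h :: real
  assumes "0 \<le> a" "0 < c" "0 < h"
  shows "(\<Sum>j=1..m. exp (- c * sinh (a + real j * h)))
           \<le> (exp (- c * sinh a) - exp (- c * sinh (a + real m * h))) / (c * h * cosh a)"
proof (induction m)
  case 0
  show ?case by simp
next
  case (Suc m)
  define b where "b = a + real m * h"
  have b: "a \<le> b" "0 \<le> b"
    using assms by (auto simp: b_def)
  have Sb: "a + real (Suc m) * h = b + h"
    by (simp add: b_def algebra_simps)
  have "h \<le> sinh h"
    using real_le_x_sinh[of h] assms by (simp add: sinh_def exp_minus)
  then have "sinh b * 1 + cosh b * h \<le> sinh b * cosh h + cosh b * sinh h"
    using b by (intro add_mono mult_left_mono cosh_real_ge_1) auto
  then have "h * cosh b \<le> sinh (b + h) - sinh b"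
    by (simp add: sinh_add mult_ac)
  moreover have "h * cosh a \<le> h * cosh b"
    using assms b cosh_real_nonneg_le_iff by auto
  ultimately have "h * cosh a \<le> sinh (b + h) - sinh b"
    by linarith
  then have "c * (h * cosh a) \<le> c * (sinh (b + h) - sinh b)"
    using assms by (intro mult_left_mono) auto
  also have "\<dots> \<le> exp (c * (sinh (b + h) - sinh b)) - 1"
    using exp_ge_add_one_self[of "c * (sinh (b + h) - sinh b)"] by linarith
  finally have "exp (- c * sinh (b + h)) * (c * h * cosh a)
      \<le> exp (- c * sinh (b + h)) * (exp (c * (sinh (b + h) - sinh b)) - 1)"
    by (simp add: mult.assoc)
  also have "\<dots> = exp (- c * sinh b) - exp (- c * sinh (b + h))"
    by (simp add: algebra_simps flip: exp_add)
  finally have "exp (- c * sinh (b + h)) \<le> (exp (- c * sinh b) - exp (- c * sinh (b + h))) / (c * h * cosh a)"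
    using assms by (simp add: pos_le_divide_eq)
  with Suc.IH show ?case
    unfolding Sb by (simp add: b_def diff_divide_distrib algebra_simps)
qed

lemma real_mult_sinh_le: "0 \<le> s \<Longrightarrow> real n * sinh s \<le> sinh (real n * s)" for s :: real
proof (induction n)
  case (Suc n)
  have "real n * sinh s * 1 + 1 * sinh s \<le> sinh (real n * s) * cosh s + cosh (real n * s) * sinh s"
    using Suc cosh_real_ge_1 by (intro add_mono mult_mono) auto
  then show ?case
    by (simp add: algebra_simps sinh_add)
qed auto

text \<open>
  For integer factors, monotonicity of \<open>q\<close> is the inequality \<open>arsinh (n * t) \<le> n * arsinh t\<close>, the inverse
  form of \<open>n * sinh s \<le> sinh (n * s)\<close>.
\<close>

lemma q_mono_nat:
  assumes "0 < t" "0 < n"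
  shows "q t \<le> q (real n * t)"
proof -
  have "sinh (arsinh (real n * t)) \<le> sinh (real n * arsinh t)"
    using real_mult_sinh_le[of "arsinh t" n] assms by (simp add: arsinh_real_pos_iff less_imp_le)
  then have "arsinh (real n * t) \<le> real n * arsinh t"
    by (simp only: sinh_real_le_iff)
  then have "t / arsinh t \<le> real n * t / arsinh (real n * t)"
    using assms by (simp add: field_simps)
  then show ?thesis by (simp add: q_def)
qed

section \<open>The interpolation error as a contour integral\<close>

text \<open>
  A uniform bound on the integrand would be useless for a segment whose length tends to infinity;
  the bound \<open>g\<close> may decay along the segment.
\<close>

lemma norm_contour_integral_horizontal_le:
  fixes f :: "complex \<Rightarrow> complex" and g :: "real \<Rightarrow> real"
  assumes cont: "continuous_on (closed_segment (Complex a v) (Complex b v)) f"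
      and "a < b" and g: "g integrable_on {a..b}"
      and le: "\<And>t. t \<in> {a..b} \<Longrightarrow> norm (f (Complex t v)) \<le> g t"
  shows "norm (contour_integral (linepath (Complex a v) (Complex b v)) f) \<le> integral {a..b} g"
proof -
  have shift: "linepath (Complex a v) (Complex b v) t = linepath (of_real a) (of_real b) t + \<i> * v" for t
    by (simp add: linepath_def complex_eq_iff algebra_simps)
  have "f contour_integrable_on linepath (Complex a v) (Complex b v)"
    using cont by (rule contour_integrable_continuous_linepath)
  then have "(f has_contour_integral contour_integral (linepath (Complex a v) (Complex b v)) f)
               (linepath (Complex a v) (Complex b v))"
    by (rule has_contour_integral_integral)
  moreover have "Complex b v - Complex a v = of_real b - of_real a"
    by (simp add: complex_eq_iff)
  ultimately have "((\<lambda>z. f (z + \<i> * v)) has_contour_integral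
      contour_integral (linepath (Complex a v) (Complex b v)) f) (linepath (of_real a) (of_real b))"
    by (simp add: has_contour_integral_linepath shift)
  then have *: "((\<lambda>t. f (Complex t v)) has_integral
      contour_integral (linepath (Complex a v) (Complex b v)) f) {a..b}"
    using \<open>a < b\<close> by (subst (asm) has_contour_integral_linepath_Reals_iff) (auto simp: Complex_eq)
  show ?thesis
    using integral_norm_bound_integral[OF has_integral_integrable[OF *] g le] integral_unique[OF *] by simp
qed

text \<open>
  Both follow from \<open>\<bar>sin z\<bar>\<^sup>2 = sin\<^sup>2 (Re z) + sinh\<^sup>2 (Im z)\<close>. The first estimate serves on the horizontal
  sides of the contour, the second on the vertical ones.
\<close>

lemma norm_sin_ge:
  shows "\<bar>sinh (Im z)\<bar> \<le> norm (sin z)" and "\<bar>sin (Re z)\<bar> \<le> norm (sin z)"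
proof -
  have "(norm (sin z))\<^sup>2 = (sin (Re z) * cosh (Im z))\<^sup>2 + (cos (Re z) * sinh (Im z))\<^sup>2"
    by (simp add: cmod_power2 Re_sin Im_sin cosh_def sinh_def)
  also have "\<dots> = (sin (Re z))\<^sup>2 + (sinh (Im z))\<^sup>2"
    by (simp add: power_mult_distrib cosh_square_eq cos_squared_eq algebra_simps)
  finally have eq: "(norm (sin z))\<^sup>2 = (sin (Re z))\<^sup>2 + (sinh (Im z))\<^sup>2" .
  show "\<bar>sinh (Im z)\<bar> \<le> norm (sin z)"
    by (rule power2_le_imp_le) (simp_all add: eq)
  show "\<bar>sin (Re z)\<bar> \<le> norm (sin z)"
    by (rule power2_le_imp_le) (simp_all add: eq)
qed

text \<open>
  Since \<open>f p = 0\<close> is allowed, the point \<open>p\<close> may be a removable singularity of the quotient instead of a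
  pole. This happens below whenever \<open>F\<close> vanishes at a node.
\<close>

lemma residue_divide_simple_zero:
  assumes S: "open S" "p \<in> S" and f: "f holomorphic_on S" and g: "g holomorphic_on S"
      and p: "g p = 0" "(g has_field_derivative g') (at p)" "g' \<noteq> 0"
      and nz: "\<And>w. w \<in> S - {p} \<Longrightarrow> g w \<noteq> 0"
  shows "residue (\<lambda>w. f w / g w) p = f p / g'"
proof (rule residue_simple'[OF S])
  show "(\<lambda>w. f w / g w) holomorphic_on S - {p}"
    using nz by (intro holomorphic_intros holomorphic_on_subset[OF f] holomorphic_on_subset[OF g]) auto
  have "(f \<longlongrightarrow> f p) (at p)"
    using f S holomorphic_on_imp_continuous_on continuous_on_eq_continuous_at isContD by blast
  moreover have "((\<lambda>w. (g w - g p) / (w - p)) \<longlongrightarrow> g') (at p)"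
    using p(2) by (simp add: has_field_derivative_iff)
  ultimately have "((\<lambda>w. f w / ((g w - g p) / (w - p))) \<longlongrightarrow> f p / g') (at p)"
    using p(3) by (rule tendsto_divide)
  then show "((\<lambda>w. f w / g w * (w - p)) \<longlongrightarrow> f p / g') (at p)"
    by (simp add: p(1))
qed

lemma cos_int_pi_squared: "(cos (pi * of_int k))\<^sup>2 = (1 :: real)"
  by (simp add: cos_squared_eq sin_times_pi_eq_0 mult.commute)

text \<open>
  The right-hand side is, up to sign, \<open>sin (pi * x / h)\<close> times the inverse of the derivative of
  \<open>(z - x) * sin (pi * z / h)\<close> at the node \<open>z = k * h\<close>; this is how sinc functions arise as residues.
\<close>

lemma nsinc_shift:
  fixes x h :: real and k :: int
  assumes "h \<noteq> 0" "x \<noteq> of_int k * h"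
  shows "nsinc ((x - of_int k * h) / h) =
         - sin (pi * x / h) / ((of_int k * h - x) * (pi / h * cos (pi * of_int k)))"
proof -
  have "sin (pi * ((x - of_int k * h) / h)) = sin (pi * x / h - pi * of_int k)"
    using assms by (simp add: field_simps)
  also have "\<dots> = sin (pi * x / h) * cos (pi * of_int k)"
    by (simp add: sin_diff sin_times_pi_eq_0 mult.commute[of pi])
  finally have s: "sin (pi * ((x - of_int k * h) / h)) = sin (pi * x / h) * cos (pi * of_int k)" .
  have "cos (pi * of_int k) * cos (pi * of_int k) = (1 :: real)"
    using cos_int_pi_squared[of k] by (simp add: power2_eq_square)
  then have c: "cos (pi * of_int k) = 1 / cos (pi * of_int k :: real)"
    by (metis divide_self_if mult_zero_left nonzero_mult_div_cancel_left zero_neq_one eq_divide_eq)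
  have "nsinc ((x - of_int k * h) / h) = sin (pi * x / h) * cos (pi * of_int k) / (pi * ((x - of_int k * h) / h))"
    using assms unfolding nsinc_def s by simp
  also have "\<dots> = sin (pi * x / h) * (1 / cos (pi * of_int k)) / (pi * ((x - of_int k * h) / h))"
    by (subst c) (rule refl)
  also have "\<dots> = - sin (pi * x / h) / ((of_int k * h - x) * (pi / h * cos (pi * of_int k)))"
    using assms by (simp add: divide_simps) (simp add: algebra_simps)
  finally show ?thesis .
qed

lemma nsinc_of_int: "nsinc (of_int k) = (if k = 0 then 1 else 0)"
  by (simp add: nsinc_def sin_times_pi_eq_0 mult.commute[of pi])

text \<open>
  The singularities of the integrand inside the rectangle are \<open>x\<close> and the nodes \<open>k * h\<close> with \<open>\<bar>k\<bar> \<le> m\<close>,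
  at most simple poles. After multiplication by \<open>sin (pi * x / h)\<close>, the residue at \<open>x\<close> becomes \<open>F x\<close> and the residues at the nodes become
  the terms of the sinc interpolant, with a minus sign. The vertical sides lie midway between two
  nodes, so that they avoid the poles.
\<close>

lemma sinc_interpolation_contour:
  fixes F :: "complex \<Rightarrow> complex" and d y h x :: real and m :: nat
  assumes F: "F analytic_on strip d" and y: "0 < y" "y < d" and h: "0 < h"
      and x: "\<bar>x\<bar> < (real m + 1 / 2) * h" "\<And>k::int. x \<noteq> of_int k * h"
  defines "A \<equiv> (real m + 1 / 2) * h"
  shows "contour_integral (rectpath (Complex (- A) (- y)) (Complex A y))
           (\<lambda>z. F z / ((z - of_real x) * sin (of_real (pi / h) * z))) =
         2 * of_real pi * \<i> / of_real (sin (pi * x / h)) *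
           (F (of_real x) - (\<Sum>k=-int m..int m. F (of_real (of_int k * h)) *
               of_real (nsinc ((x - of_int k * h) / h))))"
proof -
  define s where "s = (\<lambda>z::complex. sin (of_real (pi / h) * z))"
  define g where "g = (\<lambda>z. (z - of_real x) * s z)"
  define node where "node = (\<lambda>k::int. complex_of_real (of_int k * h))"
  define S where "S = box (Complex (- ((m + 1) * h)) (- d)) (Complex ((m + 1) * h) d)"
  define P where "P = node ` {-int m..int m}"
  let ?pts = "insert (of_real x) P"
  let ?\<gamma> = "rectpath (Complex (- A) (- y)) (Complex A y)"
  have A: "0 < A" "A < (m + 1) * h" "\<bar>x\<bar> < A"
    using h x by (auto simp: A_def add_pos_pos)
  have S: "open S" "connected S"
    unfolding S_def by (auto intro: convex_connected)
  have "S \<subseteq> strip d"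
    by (auto simp: S_def strip_def in_box_complex_iff)
  then have holF: "F holomorphic_on S"
    using F analytic_imp_holomorphic analytic_on_subset by blast
  have holg: "g holomorphic_on S"
    unfolding g_def s_def by (intro holomorphic_intros)
  have s0: "s z = 0 \<longleftrightarrow> (\<exists>k. z = node k)" for z
  proof -
    have "s z = 0 \<longleftrightarrow> (\<exists>k::int. of_real (pi / h) * z = of_real (of_int k * pi))"
      unfolding s_def sin_eq_0 by (simp add: mult.commute)
    also have "\<dots> \<longleftrightarrow> (\<exists>k. z = node k)"
      using h by (simp add: node_def field_simps)
    finally show ?thesis .
  qed
  have node_inj: "inj node"
    using h by (auto simp: node_def inj_def)
  have node_x: "node k \<noteq> of_real x" for k
    using x(2)[of k] unfolding node_def of_real_eq_iff by metis
  have node_in_P: "node k \<in> P" if "\<bar>of_int k * h\<bar> < (m + 1) * h" for k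
  proof -
    have "\<bar>real_of_int k\<bar> < real m + 1"
      using that h by (simp add: abs_mult)
    then have "k \<in> {-int m..int m}" by auto
    then show ?thesis by (auto simp: P_def)
  qed
  have pts_real: "Im p = 0 \<and> \<bar>Re p\<bar> < A" if "p \<in> ?pts" for p
  proof (cases "p = of_real x")
    case False
    with that obtain k where k: "k \<in> {-int m..int m}" "p = node k"
      by (auto simp: P_def)
    then have "\<bar>real_of_int k\<bar> * h \<le> real m * h"
      using h by (intro mult_right_mono) auto
    also have "\<dots> < A" using h by (simp add: A_def)
    finally show ?thesis
      using k h by (simp add: node_def abs_mult)
  qed (use A in auto)
  have pts_S: "?pts \<subseteq> S" and pts_in: "\<And>p. p \<in> ?pts \<Longrightarrow> p \<in> box (Complex (- A) (- y)) (Complex A y)"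
    using pts_real A y unfolding S_def in_box_complex_iff by (fastforce simp: in_box_complex_iff)+
  have nz: "g z \<noteq> 0" if "z \<in> S - ?pts" for z
  proof
    assume "g z = 0"
    then have "s z = 0"
      using that by (simp add: g_def)
    then obtain k where k: "z = node k"
      using s0 by blast
    then have "\<bar>of_int k * h\<bar> < (m + 1) * h"
      using that by (auto simp: S_def in_box_complex_iff node_def)
    then show False using node_in_P that k by auto
  qed
  have cb: "cbox (Complex (- A) (- y)) (Complex A y) \<subseteq> S"
    using A y by (auto simp: S_def in_box_complex_iff in_cbox_complex_iff)
  have g0: "g p = 0" if "p \<in> ?pts" for p
    using that s0 by (auto simp: g_def P_def)
  have res: "residue (\<lambda>z. F z / g z) p = F p / g'"
    if "p \<in> ?pts" "(g has_field_derivative g') (at p)" "g' \<noteq> 0" for p g'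
  proof (rule residue_divide_simple_zero[where S = "S - (?pts - {p})"])
    show "open (S - (?pts - {p}))"
      using S by (intro open_Diff finite_imp_closed) (auto simp: P_def)
    show "p \<in> S - (?pts - {p})" using that pts_S by auto
    show "F holomorphic_on S - (?pts - {p})" "g holomorphic_on S - (?pts - {p})"
      using holF holg by (auto elim: holomorphic_on_subset)
    show "g p = 0" using that g0 by blast
    show "\<And>w. w \<in> S - (?pts - {p}) - {p} \<Longrightarrow> g w \<noteq> 0" using nz by auto
  qed (use that in auto)
  have dg: "(g has_field_derivative s p + (p - of_real x) * (of_real (pi / h) * cos (of_real (pi / h) * p))) (at p)" for p
    unfolding g_def s_def using h by (auto intro!: derivative_eq_intros)
  have sx: "s (of_real x) = of_real (sin (pi * x / h))"
    by (simp add: s_def flip: sin_of_real)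
  have sx0: "sin (pi * x / h) \<noteq> 0"
    using s0[of "of_real x"] node_x sx by (metis of_real_eq_0_iff)
  have resx: "residue (\<lambda>z. F z / g z) (of_real x) = F (of_real x) / of_real (sin (pi * x / h))"
    using res[OF _ dg] sx sx0 by simp
  have resk: "residue (\<lambda>z. F z / g z) (node k) =
      - (F (node k) * of_real (nsinc ((x - of_int k * h) / h))) / of_real (sin (pi * x / h))"
    if "k \<in> {-int m..int m}" for k
  proof -
    define D where "D = (of_int k * h - x) * (pi / h * cos (pi * of_int k))"
    have "s (node k) = 0" using s0 by blast
    moreover have "cos (of_real (pi / h) * node k) = of_real (cos (pi * of_int k))"
    proof -
      have "of_real (pi / h) * node k = complex_of_real (pi * of_int k)"
        using h by (simp add: node_def)
      then show ?thesis
        by (simp only: cos_of_real)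
    qed
    ultimately have "(g has_field_derivative of_real D) (at (node k))"
      using dg[of "node k"] by (simp add: D_def node_def)
    moreover have "D \<noteq> 0"
      using x(2)[of k] h cos_int_pi_squared[of k] by (auto simp: D_def)
    ultimately have "residue (\<lambda>z. F z / g z) (node k) = F (node k) / of_real D"
      using res[of "node k"] that by (auto simp: P_def)
    also have "1 / D = - nsinc ((x - of_int k * h) / h) / sin (pi * x / h)"
      using nsinc_shift[of h x k] h x(2)[of k] sx0 by (simp add: D_def)
    then have "F (node k) / of_real D = F (node k) * of_real (- nsinc ((x - of_int k * h) / h) / sin (pi * x / h))"
      by (metis divide_inverse inverse_eq_divide of_real_inverse)
    finally show ?thesis by simp
  qed
  have "contour_integral ?\<gamma> (\<lambda>z. F z / g z) =
      2 * pi * \<i> * (\<Sum>p\<in>?pts. winding_number ?\<gamma> p * residue (\<lambda>z. F z / g z) p)"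
  proof (rule Residue_theorem[OF S])
    show "finite ?pts" by (simp add: P_def)
    show "(\<lambda>z. F z / g z) holomorphic_on S - ?pts"
      using nz by (intro holomorphic_intros holomorphic_on_subset[OF holF] holomorphic_on_subset[OF holg]) auto
    show "path_image ?\<gamma> \<subseteq> S - ?pts"
      using cb pts_in A y by (subst path_image_rectpath_cbox_minus_box) auto
    show "\<forall>z. z \<notin> S \<longrightarrow> winding_number ?\<gamma> z = 0"
      using cb A y by (auto intro!: winding_number_rectpath_outside)
  qed auto
  also have "(\<Sum>p\<in>?pts. winding_number ?\<gamma> p * residue (\<lambda>z. F z / g z) p) =
             (\<Sum>p\<in>?pts. residue (\<lambda>z. F z / g z) p)"
    using pts_in by (intro sum.cong refl) (simp add: winding_number_rectpath)
  also have "\<dots> = residue (\<lambda>z. F z / g z) (of_real x) + (\<Sum>p\<in>P. residue (\<lambda>z. F z / g z) p)"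
    using node_x by (subst sum.insert) (auto simp: P_def, metis)
  also have "(\<Sum>p\<in>P. residue (\<lambda>z. F z / g z) p) = (\<Sum>k=-int m..int m. residue (\<lambda>z. F z / g z) (node k))"
    unfolding P_def using inj_on_subset[OF node_inj] by (subst sum.reindex) auto
  also have "\<dots> = - (\<Sum>k=-int m..int m. F (node k) * of_real (nsinc ((x - of_int k * h) / h))) / of_real (sin (pi * x / h))"
    by (simp add: resk sum_negf sum_divide_distrib)
  also have "2 * pi * \<i> * (residue (\<lambda>z. F z / g z) (of_real x) +
      - (\<Sum>k=-int m..int m. F (node k) * of_real (nsinc ((x - of_int k * h) / h))) / of_real (sin (pi * x / h))) =
      2 * of_real pi * \<i> / of_real (sin (pi * x / h)) * (F (of_real x) -
        (\<Sum>k=-int m..int m. F (node k) * of_real (nsinc ((x - of_int k * h) / h))))"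
    unfolding resx by (simp add: diff_divide_distrib right_diff_distrib)
  finally show ?thesis
    unfolding g_def s_def node_def .
qed

text \<open>
  On the horizontal sides the denominator \<open>\<bar>z - x\<bar> * \<bar>sin (pi * z / h)\<bar>\<close> is at least
  \<open>y * sinh (pi * y / h)\<close>, which is the source of the exponential accuracy. On the vertical sides
  \<open>\<bar>sin (pi * z / h)\<bar> \<ge> 1\<close>, and \<open>\<bar>z - x\<bar> \<ge> A - \<bar>x\<bar>\<close> grows with \<open>m\<close>. When \<open>x\<close> is a node the contour formula
  does not apply, but the interpolant is exact there.
\<close>

lemma sinc_interpolation_error_le:
  fixes F :: "complex \<Rightarrow> complex" and G :: "real \<Rightarrow> real" and B d y h x :: real and m :: nat
  assumes F: "F analytic_on strip d" and y: "0 < y" "y < d" and h: "0 < h"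
      and x: "\<bar>x\<bar> < (real m + 1 / 2) * h"
  defines "A \<equiv> (real m + 1 / 2) * h"
  assumes G: "G integrable_on {-A..A}"
             "\<And>t v. t \<in> {-A..A} \<Longrightarrow> \<bar>v\<bar> = y \<Longrightarrow> norm (F (Complex t v)) \<le> G t"
      and B: "\<And>u v. \<bar>u\<bar> = A \<Longrightarrow> \<bar>v\<bar> \<le> y \<Longrightarrow> norm (F (Complex u v)) \<le> B"
  shows "norm (F (of_real x) - (\<Sum>k=-int m..int m. F (of_real (of_int k * h)) *
               of_real (nsinc ((x - of_int k * h) / h))))
         \<le> (integral {-A..A} G / (y * sinh (pi * y / h)) + 2 * y * B / (A - \<bar>x\<bar>)) / pi"
    (is "norm (?E m) \<le> ?R")
proof -
  have A: "0 < A" "\<bar>x\<bar> < A"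
    using h x by (auto simp: A_def add_pos_pos)
  have G0: "0 \<le> integral {-A..A} G"
  proof (rule integral_nonneg[OF G(1)])
    fix t assume "t \<in> {-A..A}"
    then have "norm (F (Complex t y)) \<le> G t" using G(2)[of t y] y by simp
    then show "0 \<le> G t" using norm_ge_zero order_trans by blast
  qed
  have B0: "0 \<le> B"
    using B[of A 0] A y norm_ge_zero[of "F (Complex A 0)"] by (simp del: norm_ge_zero)
  have sy: "0 < sinh (pi * y / h)"
    using y h by simp
  have R0: "0 \<le> ?R"
    using G0 B0 A y sy by (intro divide_nonneg_nonneg add_nonneg_nonneg mult_nonneg_nonneg) auto
  show ?thesis
  proof (cases "\<exists>k::int. x = of_int k * h")
    case True
    then obtain j :: int where j: "x = of_int j * h" by blast
    have "\<bar>real_of_int j\<bar> < real m + 1 / 2"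
      using x h by (simp add: j abs_mult)
    then have jm: "j \<in> {-int m..int m}" by auto
    have "F (of_real (of_int k * h)) * of_real (nsinc ((x - of_int k * h) / h)) =
          (if k = j then F (of_real x) else 0)" for k :: int
    proof -
      have "(x - of_int k * h) / h = of_int (j - k)"
        using h by (simp add: j field_simps)
      then show ?thesis
        by (simp only: nsinc_of_int) (simp add: j)
    qed
    then have "?E m = 0"
      using jm by simp
    then show ?thesis using R0 by simp
  next
    case False
    define f where "f = (\<lambda>z. F z / ((z - of_real x) * sin (of_real (pi / h) * z)))"
    define p1 p2 p3 p4 where "p1 = Complex (- A) (- y)" and "p2 = Complex A (- y)"
      and "p3 = Complex A y" and "p4 = Complex (- A) y"
    have rp: "rectpath p1 p3 = linepath p1 p2 +++ linepath p2 p3 +++ linepath p3 p4 +++ linepath p4 p1"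
      by (simp add: rectpath_def Let_def p1_def p2_def p3_def p4_def)
    have hor: "y * sinh (pi * y / h) \<le> norm ((z - of_real x) * sin (of_real (pi / h) * z))" if "\<bar>Im z\<bar> = y" for z
    proof -
      have "y \<le> norm (z - of_real x)"
        using abs_Im_le_cmod[of "z - of_real x"] that by simp
      moreover have "\<bar>sinh (pi * Im z / h)\<bar> = sinh (pi * y / h)"
      proof -
        have "Im z = y \<or> Im z = - y" using that by linarith
        then show ?thesis using sy by auto
      qed
      then have "sinh (pi * y / h) \<le> norm (sin (of_real (pi / h) * z))"
        using norm_sin_ge(1)[of "of_real (pi / h) * z"] by simp
      ultimately show ?thesis
        unfolding norm_mult using y sy by (intro mult_mono) auto
    qed
    have ver: "A - \<bar>x\<bar> \<le> norm ((z - of_real x) * sin (of_real (pi / h) * z))" if "\<bar>Re z\<bar> = A" for z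
    proof -
      have "A - \<bar>x\<bar> \<le> norm (z - of_real x)"
        using abs_Re_le_cmod[of "z - of_real x"] that by simp
      moreover have "\<bar>sin (pi / h * Re z)\<bar> = 1"
      proof -
        have "\<bar>sin (pi / h * Re z)\<bar> = \<bar>sin (pi / h * A)\<bar>"
          using that by (auto simp: abs_if split: if_splits)
        also have "pi / h * A = pi * real m + pi / 2"
          using h by (simp add: A_def field_simps)
        also have "\<bar>sin (pi * real m + pi / 2)\<bar> = \<bar>cos (pi * real m)\<bar>"
          by (simp add: sin_add)
        also have "\<dots> = 1"
          using cos_int_pi_squared[of "int m"] by (simp add: power2_eq_1_iff abs_if)
        finally show ?thesis .
      qed
      then have "1 \<le> norm (sin (of_real (pi / h) * z))"
        using norm_sin_ge(2)[of "of_real (pi / h) * z"] by simp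
      ultimately have "(A - \<bar>x\<bar>) * 1 \<le> norm (z - of_real x) * norm (sin (of_real (pi / h) * z))"
        using A by (intro mult_mono) auto
      then show ?thesis by (simp add: norm_mult)
    qed
    have strip: "z \<in> strip d" if "\<bar>Im z\<bar> \<le> y" for z
      using that y by (simp add: strip_def)
    have contF: "continuous_on (strip d) F"
      using F by (simp add: analytic_imp_holomorphic holomorphic_on_imp_continuous_on)
    have cont: "continuous_on T f" if "\<And>z. z \<in> T \<Longrightarrow> \<bar>Im z\<bar> \<le> y \<and> (\<bar>Im z\<bar> = y \<or> \<bar>Re z\<bar> = A)" for T
    proof -
      have "(z - of_real x) * sin (of_real (pi / h) * z) \<noteq> 0" if "z \<in> T" for z
      proof -
        have "0 < y * sinh (pi * y / h)" using y sy by simp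
        then have "0 < norm ((z - of_real x) * sin (of_real (pi / h) * z))"
          using hor[of z] ver[of z] A \<open>\<And>z. z \<in> T \<Longrightarrow> _\<close>[OF that] by auto
        then show ?thesis by simp
      qed
      moreover have "continuous_on T F"
        using continuous_on_subset[OF contF] strip that by blast
      ultimately show ?thesis
        unfolding f_def by (intro continuous_intros) auto
    qed
    have segs: "continuous_on (closed_segment p1 p2) f" "continuous_on (closed_segment p2 p3) f"
      "continuous_on (closed_segment p3 p4) f" "continuous_on (closed_segment p4 p1) f"
      by (rule cont; use A y in \<open>auto simp: p1_def p2_def p3_def p4_def closed_segment_same_Re
             closed_segment_same_Im closed_segment_eq_real_ivl split: if_splits\<close>)+
    have fhor: "norm (f (Complex t v)) \<le> G t / (y * sinh (pi * y / h))" if "t \<in> {-A..A}" "\<bar>v\<bar> = y" for t v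
    proof -
      have "norm (f (Complex t v)) = norm (F (Complex t v)) / norm ((Complex t v - of_real x) * sin (of_real (pi / h) * Complex t v))"
        by (simp add: f_def norm_divide)
      also have "\<dots> \<le> G t / (y * sinh (pi * y / h))"
        using hor[of "Complex t v"] G(2)[of t v] that y sy
        by (intro frac_le) (auto intro: order_trans[OF norm_ge_zero])
      finally show ?thesis .
    qed
    have fver: "norm (f z) \<le> B / (A - \<bar>x\<bar>)" if "\<bar>Re z\<bar> = A" "\<bar>Im z\<bar> \<le> y" for z
    proof -
      have "norm (f z) = norm (F z) / norm ((z - of_real x) * sin (of_real (pi / h) * z))"
        by (simp add: f_def norm_divide)
      also have "\<dots> \<le> B / (A - \<bar>x\<bar>)"
        using ver[of z] B[of "Re z" "Im z"] that A B0 by (intro frac_le) auto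
      finally show ?thesis .
    qed
    have intG: "(\<lambda>t. G t / (y * sinh (pi * y / h))) integrable_on {-A..A}"
      using G(1) by (rule integrable_on_divide)
    have I1: "norm (contour_integral (linepath p1 p2) f) \<le> integral {-A..A} G / (y * sinh (pi * y / h))"
      using norm_contour_integral_horizontal_le[OF segs(1)[unfolded p1_def p2_def] _ intG fhor] A y
      by (simp add: p1_def p2_def)
    have "contour_integral (linepath p3 p4) f = - contour_integral (linepath p4 p3) f"
      using segs(3) by (rule contour_integral_reverse_linepath)
    then have I3: "norm (contour_integral (linepath p3 p4) f) \<le> integral {-A..A} G / (y * sinh (pi * y / h))"
      using norm_contour_integral_horizontal_le[OF segs(3)[unfolded p3_def p4_def closed_segment_commute[of "Complex A y"]] _ intG fhor] A y
      by (simp add: p3_def p4_def)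
    have I2: "norm (contour_integral (linepath p2 p3) f) \<le> 2 * y * B / (A - \<bar>x\<bar>)"
    proof -
      have "norm (contour_integral (linepath p2 p3) f) \<le> B / (A - \<bar>x\<bar>) * norm (p3 - p2)"
        using A B0 y segs(2)
        by (intro contour_integral_bound_linepath contour_integrable_continuous_linepath fver)
           (auto simp: p2_def p3_def closed_segment_same_Re closed_segment_eq_real_ivl split: if_splits)
      also have "norm (p3 - p2) = 2 * y"
      proof -
        have "p3 - p2 = of_real (2 * y) * \<i>"
          by (simp add: p2_def p3_def complex_eq_iff)
        then show ?thesis using y by (simp only: norm_mult norm_of_real) simp
      qed
      finally show ?thesis by (simp add: mult_ac)
    qed
    have I4: "norm (contour_integral (linepath p4 p1) f) \<le> 2 * y * B / (A - \<bar>x\<bar>)"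
    proof -
      have "norm (contour_integral (linepath p4 p1) f) \<le> B / (A - \<bar>x\<bar>) * norm (p1 - p4)"
        using A B0 y segs(4)
        by (intro contour_integral_bound_linepath contour_integrable_continuous_linepath fver)
           (auto simp: p1_def p4_def closed_segment_same_Re closed_segment_eq_real_ivl split: if_splits)
      also have "norm (p1 - p4) = 2 * y"
      proof -
        have "p1 - p4 = of_real (- (2 * y)) * \<i>"
          by (simp add: p1_def p4_def complex_eq_iff)
        then show ?thesis using y by (simp only: norm_mult norm_of_real) simp
      qed
      finally show ?thesis by (simp add: mult_ac)
    qed
    have "contour_integral (rectpath p1 p3) f =
        contour_integral (linepath p1 p2) f + contour_integral (linepath p2 p3) f +
        contour_integral (linepath p3 p4) f + contour_integral (linepath p4 p1) f"
      unfolding rp using segs by (simp add: contour_integrable_continuous_linepath)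
    then have "norm (contour_integral (rectpath p1 p3) f) \<le>
        norm (contour_integral (linepath p1 p2) f) + norm (contour_integral (linepath p2 p3) f) +
        norm (contour_integral (linepath p3 p4) f) + norm (contour_integral (linepath p4 p1) f)"
      by (simp only:) (intro norm_triangle_le add_mono order_refl)
    also note add_mono[OF add_mono[OF add_mono[OF I1 I2] I3] I4]
    also have "P + Q + P + Q = 2 * pi * ((P + Q) / pi)" for P Q :: real
      by simp
    finally have I: "norm (contour_integral (rectpath p1 p3) f) \<le> 2 * pi * ?R" .
    have "contour_integral (rectpath p1 p3) f = 2 * of_real pi * \<i> / of_real (sin (pi * x / h)) * ?E m"
      using sinc_interpolation_contour[OF F y h x] False
      unfolding f_def p1_def p3_def A_def by blast
    moreover have "sin (pi * x / h) \<noteq> 0"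
    proof
      assume "sin (pi * x / h) = 0"
      then obtain k :: int where "pi * x / h = of_int k * pi"
        by (auto simp: sin_zero_iff_int2)
      then have "x = of_int k * h" using h by (simp add: field_simps)
      then show False using False by blast
    qed
    ultimately have "2 * of_real pi * \<i> * ?E m = of_real (sin (pi * x / h)) * contour_integral (rectpath p1 p3) f"
      by simp
    then have "norm (2 * of_real pi * \<i> * ?E m) = norm (of_real (sin (pi * x / h)) * contour_integral (rectpath p1 p3) f)"
      by (rule arg_cong)
    then have "2 * pi * norm (?E m) = \<bar>sin (pi * x / h)\<bar> * norm (contour_integral (rectpath p1 p3) f)"
      by (simp add: norm_mult)
    also have "\<dots> \<le> 1 * (2 * pi * ?R)"
      using I by (intro mult_mono) auto
    finally have "2 * pi * norm (?E m) \<le> 2 * pi * ?R"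
      by (simp only: mult_1)
    then show ?thesis
      by (rule mult_left_le_imp_le) simp
  qed
qed

lemma abs_nsinc_le_one: "\<bar>nsinc x\<bar> \<le> 1"
  using abs_sin_x_le_abs_x[of "pi * x"] by (simp add: nsinc_def divide_le_eq)

section \<open>Discretization and truncation error\<close>

lemma cos_half_pi_sin_mono:
  assumes "\<bar>v\<bar> \<le> y" "y < pi / 2"
  shows "0 < cos (pi / 2 * sin y)" "cos (pi / 2 * sin y) \<le> cos (pi / 2 * sin v)"
proof -
  have y: "0 \<le> y" using assms by linarith
  have "\<bar>sin v\<bar> = sin \<bar>v\<bar>"
    using sin_ge_zero[of "\<bar>v\<bar>"] assms by (auto simp: abs_if split: if_splits)
  also have "\<dots> \<le> sin y"
    using assms by (intro sin_monotone_2pi_le) auto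
  finally have v: "\<bar>sin v\<bar> \<le> sin y" .
  have "sin y < sin (pi / 2)"
    using assms y by (intro sin_monotone_2pi) auto
  then have y1: "sin y < 1" by simp
  show "0 < cos (pi / 2 * sin y)"
    using y1 v by (intro cos_gt_zero_pi) (auto intro: less_le_trans[of _ 0])
  have "cos (pi / 2 * sin y) \<le> cos \<bar>pi / 2 * sin v\<bar>"
    using v y1 by (intro cos_monotone_0_pi_le) (auto simp: abs_mult)
  then show "cos (pi / 2 * sin y) \<le> cos (pi / 2 * sin v)"
    by (simp only: cos_abs_real)
qed

text \<open>
  The constant \<open>K\<close> bounds \<open>F\<close> on the whole rectangle, because \<open>cos (pi / 2 * sin v)\<close> is smallest on its
  horizontal sides. There, the decay rate is the same for all points, and the integral of the
  resulting double exponential is at most \<open>2 * K / (pi * min \<alpha> \<beta> * cos y)\<close>.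
\<close>

lemma L_DE_sinc_error_le:
  fixes h x y :: real and m :: nat
  assumes F: "F \<in> L_DE L R \<alpha> \<beta> d" and pos: "0 < L" "0 < \<alpha>" "0 < \<beta>"
      and y: "0 < y" "y < d" "d \<le> pi / 2" and h: "0 < h" and x: "\<bar>x\<bar> < (real m + 1 / 2) * h"
  defines "K \<equiv> L / cos (pi / 2 * sin y) powr (\<alpha> + \<beta>)"
  shows "norm (F (of_real x) - (\<Sum>k=-int m..int m. F (of_real (of_int k * h)) *
               of_real (nsinc ((x - of_int k * h) / h))))
         \<le> (2 * K / (pi * min \<alpha> \<beta> * cos y) / (y * sinh (pi * y / h)) +
             2 * y * K / ((real m + 1 / 2) * h - \<bar>x\<bar>)) / pi"
proof -
  define A where "A = (real m + 1 / 2) * h"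
  define c where "c = pi * min \<alpha> \<beta> * cos y"
  define g where "g = (\<lambda>t. cosh t * exp (- c * \<bar>sinh t\<bar>))"
  have A: "0 \<le> A" using h by (simp add: A_def)
  have c: "0 < c"
    using pos y by (auto simp: c_def intro!: mult_pos_pos cos_gt_zero_pi)
  have K: "0 < K"
    using cos_half_pi_sin_mono(1)[of 0 y] y pos by (simp add: K_def)
  have decay: "norm (F (Complex t v)) \<le> L / cos (pi / 2 * sin v) powr (\<alpha> + \<beta>) *
           exp (- (pi * min \<alpha> \<beta> * cos v) * \<bar>sinh t\<bar>)" if "\<bar>v\<bar> \<le> y" for t v
    using L_DE_decay[OF F, of "Complex t v"] pos y that by (simp add: strip_def)
  have g: "g integrable_on {-A..A}" "integral {-A..A} g \<le> 2 / c"
    unfolding g_def using integral_cosh_exp_sinh_le[OF c A] by auto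
  have "norm (F (of_real x) - (\<Sum>k=-int m..int m. F (of_real (of_int k * h)) *
               of_real (nsinc ((x - of_int k * h) / h))))
      \<le> (integral {-A..A} (\<lambda>t. K * g t) / (y * sinh (pi * y / h)) + 2 * y * K / (A - \<bar>x\<bar>)) / pi"
    unfolding A_def
  proof (rule sinc_interpolation_error_le[OF _ y(1,2) h x])
    show "F analytic_on strip d"
      using F by (simp add: L_DE_def)
    show "(\<lambda>t. K * g t) integrable_on {- ((real m + 1 / 2) * h)..(real m + 1 / 2) * h}"
      using g(1) unfolding A_def by (rule integrable_on_mult_right)
    show "norm (F (Complex t v)) \<le> K * g t" if "\<bar>v\<bar> = y" for t v
    proof -
      have "v = y \<or> v = - y" using that by linarith
      then have "norm (F (Complex t v)) \<le> K * exp (- c * \<bar>sinh t\<bar>)"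
        using decay[of v t] y by (auto simp: K_def c_def)
      also have "\<dots> \<le> K * (cosh t * exp (- c * \<bar>sinh t\<bar>))"
        using K cosh_real_ge_1[of t] by (intro mult_left_mono) auto
      finally show ?thesis by (simp add: g_def)
    qed
    show "norm (F (Complex u v)) \<le> K" if "\<bar>v\<bar> \<le> y" for u v
    proof -
      have "0 \<le> cos v"
        using that y by (intro cos_ge_zero) auto
      then have "norm (F (Complex u v)) \<le> L / cos (pi / 2 * sin v) powr (\<alpha> + \<beta>) * 1"
        using pos by (intro order_trans[OF decay[OF that]] mult_left_mono) (auto simp: mult_nonpos_nonneg)
      also have "\<dots> \<le> K * 1"
        unfolding K_def using cos_half_pi_sin_mono[OF that] y pos
        by (intro mult_right_mono divide_left_mono powr_mono2 mult_pos_pos) auto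
      finally show ?thesis by simp
    qed
  qed
  also have "\<dots> \<le> (K * (2 / c) / (y * sinh (pi * y / h)) + 2 * y * K / (A - \<bar>x\<bar>)) / pi"
  proof (intro divide_right_mono add_right_mono)
    show "integral {-A..A} (\<lambda>t. K * g t) \<le> K * (2 / c)"
      using mult_left_mono[OF g(2), of K] K by simp
  qed (use y h in auto)
  finally show ?thesis
    by (simp add: A_def c_def mult.commute)
qed

text \<open>
  The hypothesis on \<open>N\<close> says \<open>sinh (N * h) \<ge> s\<close>. It is used twice: in the exponent, and as
  \<open>cosh (N * h) \<ge> s\<close> in the denominator that \<open>sum_exp_sinh_le\<close> provides.
\<close>

lemma tail_sum_le:
  fixes f :: "int \<Rightarrow> real" and N m :: int
  assumes f: "\<And>k. k > N \<Longrightarrow> f k \<le> R * exp (- c * sinh (of_int k * h))"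
      and pos: "0 < c" "0 < h" "0 < s" "0 \<le> R" and N: "arsinh s \<le> of_int N * h"
  shows "(\<Sum>k=N+1..m. f k) \<le> R * exp (- c * s) / (c * h * s)"
proof -
  define p where "p = nat (m - N)"
  have N0: "0 \<le> of_int N * h"
    using N pos by (intro order_trans[OF _ N]) (simp add: less_imp_le)
  have s: "s \<le> sinh (of_int N * h)"
    using N sinh_real_le_iff[of "arsinh s" "of_int N * h"] by simp
  also have "\<dots> \<le> cosh (of_int N * h)"
    by (simp add: sinh_le_cosh_real)
  finally have c: "s \<le> cosh (of_int N * h)" .
  have "(\<Sum>k=N+1..m. f k) = (\<Sum>j=1..p. f (N + int j))"
    by (rule sum.reindex_bij_witness[where i = "\<lambda>j. N + int j" and j = "\<lambda>k. nat (k - N)"])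
       (auto simp: p_def)
  also have "\<dots> \<le> (\<Sum>j=1..p. R * exp (- c * sinh (of_int N * h + real j * h)))"
  proof (rule sum_mono)
    fix j assume "j \<in> {1..p}"
    then show "f (N + int j) \<le> R * exp (- c * sinh (of_int N * h + real j * h))"
      using f[of "N + int j"] by (simp add: distrib_right)
  qed
  also have "\<dots> = R * (\<Sum>j=1..p. exp (- c * sinh (of_int N * h + real j * h)))"
    by (simp add: sum_distrib_left)
  also have "\<dots> \<le> R * ((exp (- c * sinh (of_int N * h)) - exp (- c * sinh (of_int N * h + real p * h)))
                    / (c * h * cosh (of_int N * h)))"
    using pos N0 by (intro mult_left_mono sum_exp_sinh_le) auto
  also have "\<dots> \<le> R * (exp (- c * s) / (c * h * s))"
  proof (intro mult_left_mono frac_le)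
    have "exp (- c * sinh (of_int N * h)) \<le> exp (- c * s)"
      using s pos by simp
    then show "exp (- c * sinh (of_int N * h)) - exp (- c * sinh (of_int N * h + real p * h)) \<le> exp (- c * s)"
      using exp_gt_zero[of "- c * sinh (of_int N * h + real p * h)"] by linarith
  qed (use pos c in auto)
  finally show ?thesis by simp
qed

lemma sum_split_three:
  fixes f :: "int \<Rightarrow> complex"
  assumes "0 \<le> M" "0 \<le> N" "M \<le> m" "N \<le> m"
  shows "(\<Sum>k=-m..m. f k) = (\<Sum>k=-M..N. f k) + (\<Sum>k=M+1..m. f (- k)) + (\<Sum>k=N+1..m. f k)"
proof -
  have split: "sum f {a..c} = sum f {a..b} + sum f {b+1..c}" if "a \<le> b + 1" "b \<le> c" for a b c
  proof -
    have "{a..c} = {a..b} \<union> {b+1..c}" using that by auto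
    then show ?thesis by (simp add: sum.union_disjoint)
  qed
  have "sum f {-m..-M-1} = (\<Sum>k=M+1..m. f (- k))"
    by (rule sum.reindex_bij_witness[where i = uminus and j = uminus]) auto
  then show ?thesis
    using split[of "-m" "-M-1" m] split[of "-M" N m] assms by simp
qed

text \<open>
  The first summand bounds the error of the interpolant that uses all nodes, the other two bound the
  terms dropped on the left and on the right. The estimate is derived for the symmetric partial sums
  of large order \<open>m\<close>, with a contribution from the vertical sides that vanishes as \<open>m\<close> tends to
  infinity; the tail bounds are uniform in \<open>m\<close>. As \<open>F\<close> need not extend to the boundary of the strip, the contours
  have height \<open>y < d\<close>, and \<open>y\<close> tends to \<open>d\<close> only in the final bound.
\<close>

lemma L_DE_truncated_sinc_error_le:
  fixes h x s t :: real and M N :: int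
  assumes F: "F \<in> L_DE L R \<alpha> \<beta> d" and pos: "0 < L" "0 < R" "0 < \<alpha>" "0 < \<beta>"
      and d: "0 < d" "d < pi / 2" and h: "0 < h"
      and s: "0 < s" "arsinh s \<le> of_int M * h" and t: "0 < t" "arsinh t \<le> of_int N * h"
  shows "norm (F (of_real x) - (\<Sum>k=-M..N. F (of_real (of_int k * h)) *
               of_real (nsinc ((x - of_int k * h) / h))))
         \<le> 2 * (L / cos (pi / 2 * sin d) powr (\<alpha> + \<beta>)) / (pi * min \<alpha> \<beta> * cos d) / (d * sinh (pi * d / h)) / pi
           + R * exp (- (pi * \<alpha>) * s) / (pi * \<alpha> * h * s)
           + R * exp (- (pi * \<beta>) * t) / (pi * \<beta> * h * t)"
proof -
  define f where "f = (\<lambda>k::int. F (of_real (of_int k * h)) * of_real (nsinc ((x - of_int k * h) / h)))"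
  define K where "K = (\<lambda>y. L / cos (pi / 2 * sin y) powr (\<alpha> + \<beta>))"
  define D where "D = (\<lambda>y. 2 * K y / (pi * min \<alpha> \<beta> * cos y) / (y * sinh (pi * y / h)) / pi)"
  define T1 T2 where "T1 = R * exp (- (pi * \<alpha>) * s) / (pi * \<alpha> * h * s)"
    and "T2 = R * exp (- (pi * \<beta>) * t) / (pi * \<beta> * h * t)"
  let ?E = "norm (F (of_real x) - (\<Sum>k=-M..N. f k))"
  have "0 < arsinh s" "0 < arsinh t" using s t by simp_all
  then have "0 < of_int M * h" "0 < of_int N * h" using s t by linarith+
  then have MN: "0 \<le> M" "0 \<le> N" using h by (auto simp: zero_less_mult_iff)
  have f_le: "norm (f k) \<le> norm (F (of_real (of_int k * h)))" for k
    unfolding f_def norm_mult using abs_nsinc_le_one by (intro mult_left_le) auto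
  have tail1: "norm (\<Sum>k=M+1..m. f (- k)) \<le> T1" for m
  proof -
    have "norm (f (- k)) \<le> R * exp (- (pi * \<alpha>) * sinh (of_int k * h))" for k
      using f_le[of "- k"] L_DE_decay_real(2)[OF F, of "- (of_int k * h)"] pos by simp
    then have "(\<Sum>k=M+1..m. norm (f (- k))) \<le> T1"
      unfolding T1_def using pos h s by (intro tail_sum_le) auto
    then show ?thesis
      by (rule order_trans[OF norm_sum])
  qed
  have tail2: "norm (\<Sum>k=N+1..m. f k) \<le> T2" for m
  proof -
    have "norm (f k) \<le> R * exp (- (pi * \<beta>) * sinh (of_int k * h))" for k
      using f_le[of k] L_DE_decay_real(1)[OF F, of "of_int k * h"] pos by simp
    then have "(\<Sum>k=N+1..m. norm (f k)) \<le> T2"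
      unfolding T2_def using pos h t by (intro tail_sum_le) auto
    then show ?thesis
      by (rule order_trans[OF norm_sum])
  qed
  have step: "?E \<le> D y + (T1 + T2)" if y: "0 < y" "y < d" for y
  proof -
    define e where "e = (\<lambda>m::nat. 2 * y * K y / ((real m + 1 / 2) * h - \<bar>x\<bar>) / pi)"
    have "filterlim (\<lambda>m::nat. (h / 2 - \<bar>x\<bar>) + h * real m) at_top sequentially"
      by (intro filterlim_tendsto_add_at_top[OF tendsto_const] filterlim_real_sequentially
                filterlim_tendsto_pos_mult_at_top[OF tendsto_const h])
    then have top: "filterlim (\<lambda>m::nat. (real m + 1 / 2) * h - \<bar>x\<bar>) at_top sequentially"
      by (simp add: algebra_simps)
    then have "(\<lambda>m. 2 * y * K y / ((real m + 1 / 2) * h - \<bar>x\<bar>)) \<longlonglongrightarrow> 0"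
      by (intro tendsto_divide_0[OF tendsto_const] filterlim_at_top_imp_at_infinity)
    then have "e \<longlonglongrightarrow> 0 / pi"
      unfolding e_def by (intro tendsto_divide tendsto_const) auto
    then have lim: "(\<lambda>m. D y + e m + (T1 + T2)) \<longlonglongrightarrow> D y + 0 + (T1 + T2)"
      by (intro tendsto_add tendsto_const) simp
    have "eventually (\<lambda>m. 0 < (real m + 1 / 2) * h - \<bar>x\<bar>) sequentially"
      using top unfolding filterlim_at_top_dense by blast
    then have "eventually (\<lambda>m. ?E \<le> D y + e m + (T1 + T2)) sequentially"
      using eventually_ge_at_top[of "nat (max M N)"]
    proof eventually_elim
      case (elim m)
      then have m: "M \<le> int m" "N \<le> int m" by auto
      have "F (of_real x) - (\<Sum>k=-M..N. f k) =
          (F (of_real x) - (\<Sum>k=-int m..int m. f k)) + ((\<Sum>k=M+1..int m. f (- k)) + (\<Sum>k=N+1..int m. f k))"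
        by (simp add: sum_split_three[OF MN m])
      then have "?E \<le> norm (F (of_real x) - (\<Sum>k=-int m..int m. f k)) +
          (norm (\<Sum>k=M+1..int m. f (- k)) + norm (\<Sum>k=N+1..int m. f k))"
        by (simp only:) (intro norm_triangle_le add_mono order_refl)
      also have "norm (F (of_real x) - (\<Sum>k=-int m..int m. f k)) \<le> D y + e m"
        using L_DE_sinc_error_le[OF F pos(1,3,4) y _ h, of x m] elim d
        by (simp add: f_def D_def e_def K_def add_divide_distrib)
      finally show ?case
        using tail1[of "int m"] tail2[of "int m"] by linarith
    qed
    then show ?thesis
      using tendsto_lowerbound[OF lim] by simp
  qed
  have "isCont D d"
    unfolding D_def K_def using cos_half_pi_sin_mono(1)[of 0 d] cos_gt_zero_pi[of d] d h pos
    by (intro continuous_intros) auto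
  then have "(D \<longlongrightarrow> D d) (at_left d)"
    by (simp add: isCont_def filterlim_at_split)
  then have "((\<lambda>y. D y + (T1 + T2)) \<longlongrightarrow> D d + (T1 + T2)) (at_left d)"
    by (intro tendsto_add tendsto_const)
  moreover have "eventually (\<lambda>y. ?E \<le> D y + (T1 + T2)) (at_left d)"
    using step d by (intro eventually_at_leftI[of 0]) auto
  ultimately have "?E \<le> D d + (T1 + T2)"
    by (intro tendsto_lowerbound) auto
  then show ?thesis
    by (simp add: f_def D_def K_def T1_def T2_def)
qed

section \<open>The error bound for the prescribed mesh and cut-offs\<close>

theorem theorem2p3:
  fixes L R \<alpha> \<beta> d \<mu> h C :: real and F :: "complex \<Rightarrow> complex" and n :: nat and M N :: int
  assumes "L > 0" and "R > 0" and "\<alpha> > 0" and "\<beta> > 0"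
    and "0 < d" and "d < pi / 2"
    and "F \<in> L_DE L R \<alpha> \<beta> d"
    and "\<mu> = min \<alpha> \<beta>"
    and "n > 0"
    and "h = arsinh (d * real n / \<mu>) / real n"
    and "M = \<lceil>1 / h * arsinh (\<mu> / \<alpha> * q (d * real n / \<mu>))\<rceil>"
    and "N = \<lceil>1 / h * arsinh (\<mu> / \<beta> * q (d * real n / \<mu>))\<rceil>"
    and "C = 2 / (pi * d) *
           (2 * L / (pi * \<mu> * (1 - exp (- 2 * pi * \<mu> * q (d / \<mu>))) *
                     cos (pi / 2 * sin d) powr (\<alpha> + \<beta>) * cos d) + R)"
  shows "(SUP x::real. ereal (norm (F (of_real x) -
            (\<Sum>k = - M..N. F (of_real (of_int k * h)) *
                           of_real (nsinc ((x - of_int k * h) / h))))))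
         \<le> ereal (C * exp (- pi * d * real n / arsinh (d * real n / \<mu>)))"
proof (rule SUP_least)
  fix x :: real
  define Q where "Q = q (d * real n / \<mu>)"
  define w where "w = pi * d / h"
  define \<kappa> where "\<kappa> = cos (pi / 2 * sin d) powr (\<alpha> + \<beta>)"
  have \<mu>: "0 < \<mu>" using assms by simp
  have arg: "0 < d * real n / \<mu>" using assms \<mu> by simp
  then have ar: "0 < arsinh (d * real n / \<mu>)" by simp
  have h: "0 < h" using ar assms by simp
  have Q: "0 < Q" using divide_pos_pos[OF arg ar] by (simp only: Q_def q_def)
  \<comment> \<open>The mesh size is chosen for this identity: the exponent \<open>pi * d / h\<close> of the discretization error
      agrees with the exponent \<open>pi * \<mu> * Q\<close> of both tails.\<close>
  have \<mu>Q: "\<mu> * Q = d / h"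
    using \<mu> assms(9) by (simp add: Q_def q_def assms(10))
  have w: "w = pi * d * real n / arsinh (d * real n / \<mu>)" "w = pi * (\<mu> * Q)"
    by (simp_all add: w_def assms(10) \<mu>Q)
  have w0: "0 < w" using h assms by (simp add: w_def)
  have \<kappa>: "0 < \<kappa>" "0 < cos d"
    using cos_half_pi_sin_mono(1)[of 0 d] cos_gt_zero_pi[of d] assms by (simp_all add: \<kappa>_def)
  have q0: "0 < q (d / \<mu>)"
    using assms \<mu> by (simp add: q_def)
  have q_le: "q (d / \<mu>) \<le> Q"
    using q_mono_nat[of "d / \<mu>" n] assms \<mu> by (simp add: Q_def mult.commute)
  have ceil: "a \<le> of_int \<lceil>1 / h * a\<rceil> * h" for a
  proof -
    have "a / h \<le> of_int \<lceil>1 / h * a\<rceil>"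
      using le_of_int_ceiling[of "1 / h * a"] by simp
    then show ?thesis using h by (simp only: pos_divide_le_eq)
  qed
  have tail: "R * exp (- (pi * \<gamma>) * (\<mu> / \<gamma> * Q)) / (pi * \<gamma> * h * (\<mu> / \<gamma> * Q)) = R * exp (- w) / (pi * d)"
    if "0 < \<gamma>" for \<gamma>
  proof -
    have "(pi * \<gamma>) * (\<mu> / \<gamma> * Q) = w" "pi * \<gamma> * h * (\<mu> / \<gamma> * Q) = pi * h * (\<mu> * Q)"
      using that by (simp_all add: w(2))
    then show ?thesis
      using h by (simp add: \<mu>Q)
  qed
  \<comment> \<open>\<open>1 / sinh w\<close> is \<open>2 * exp (- w)\<close> up to a factor that depends on \<open>n\<close>; its largest value,
      attained at \<open>n = 1\<close>, makes the constant independent of \<open>n\<close>.\<close>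
  have sinh_w: "1 / sinh w \<le> 2 * exp (- w) / (1 - exp (- 2 * pi * \<mu> * q (d / \<mu>)))"
  proof -
    have "1 / sinh w = 2 * exp (- w) / (1 - exp (- 2 * w))"
    proof -
      have "2 * exp (- w) * sinh w = 1 - exp (- 2 * w)"
        by (simp add: sinh_def algebra_simps flip: exp_add)
      moreover have "0 < sinh w" "exp (- 2 * w) < 1" using w0 by simp_all
      ultimately show ?thesis by (simp add: field_simps)
    qed
    also have "\<dots> \<le> 2 * exp (- w) / (1 - exp (- 2 * pi * \<mu> * q (d / \<mu>)))"
    proof (intro divide_left_mono mult_pos_pos)
      have "\<mu> * q (d / \<mu>) \<le> \<mu> * Q" using q_le \<mu> by simp
      then show "1 - exp (- 2 * pi * \<mu> * q (d / \<mu>)) \<le> 1 - exp (- 2 * w)"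
        by (simp add: w(2) mult.assoc)
    qed (use \<mu> q0 w0 in auto)
    finally show ?thesis .
  qed
  have levels: "0 < \<mu> / \<alpha> * Q" "0 < \<mu> / \<beta> * Q"
    using \<mu> Q assms by simp_all
  have nodes: "arsinh (\<mu> / \<alpha> * Q) \<le> of_int M * h" "arsinh (\<mu> / \<beta> * Q) \<le> of_int N * h"
    unfolding assms(11,12) Q_def by (rule ceil)+
  have "norm (F (of_real x) - (\<Sum>k = - M..N. F (of_real (of_int k * h)) * of_real (nsinc ((x - of_int k * h) / h))))
      \<le> 2 * (L / \<kappa>) / (pi * \<mu> * cos d) / (d * sinh w) / pi + R * exp (- w) / (pi * d) + R * exp (- w) / (pi * d)"
    using L_DE_truncated_sinc_error_le[OF assms(7) assms(1-6) h levels(1) nodes(1) levels(2) nodes(2), of x]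
    unfolding tail[OF assms(3)] tail[OF assms(4)] assms(8)[symmetric] w_def[symmetric] \<kappa>_def[symmetric] .
  also have "2 * (L / \<kappa>) / (pi * \<mu> * cos d) / (d * sinh w) / pi
      = 2 * L / (pi * \<mu> * \<kappa> * cos d) / (pi * d) * (1 / sinh w)"
    by simp
  also have "\<dots> \<le> 2 * L / (pi * \<mu> * \<kappa> * cos d) / (pi * d) * (2 * exp (- w) / (1 - exp (- 2 * pi * \<mu> * q (d / \<mu>))))"
    using sinh_w \<kappa> \<mu> assms by (intro mult_left_mono) auto
  also have "\<dots> + R * exp (- w) / (pi * d) + R * exp (- w) / (pi * d) = C * exp (- w)"
    unfolding assms(13) \<kappa>_def[symmetric] by (simp add: distrib_left distrib_right mult_ac)
  finally show "ereal (norm (F (of_real x) - (\<Sum>k = - M..N. F (of_real (of_int k * h)) *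
                           of_real (nsinc ((x - of_int k * h) / h)))))
         \<le> ereal (C * exp (- pi * d * real n / arsinh (d * real n / \<mu>)))"
    by (simp add: w(1))
qed

end
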